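(* Let $\mathcal{F}$ be a one-dimensional holomorphic foliation on the toric surface $\mathbb{P}_{\Delta(0,2,1)}$ and let $X$ be a quasi-homogeneous vector field which defines $\mathcal{F}$ in homogeneous coordinates. Let $V\subset\mathbb{P}_{\Delta(0,2,1)}$ be a quasi-smooth hypersurface invariant by $\mathcal{F}$. Then $$\deg(V)_1\leq\deg(\mathcal{F})_1+2.$$
   Context: $\mathbb{P}_{\Delta(0,2,1)}$ is the compact toric orbifold surface of the complete simplicial fan in $\mathbb{Z}^2$ with rays generated by $v_1=2e_1-e_2$, $v_2=-e_1+2e_2$, $v_3=-e_1-e_2$. Its Weil divisor class group is $\mathcal{A}_1(\mathbb{P}_{\Delta(0,2,1)})\simeq\mathbb{Z}\oplus\mathbb{Z}_3$, and it is the quotient $(\mathbb{C}^3\setminus\{0\})/(\mathbb{C}^*\times\mu_3)$ for the action $(t,\omega)\cdot(z_1,z_2,z_3)=(t\omega z_1,tz_2,t\omega^2z_3)$, where $\mu_3$ is the group of cube roots of unity. Its homogeneous coordinate ring is $\mathrm{S}=\mathbb{C}[z_1,z_2,z_3]$, graded by $\mathbb{Z}\oplus\mathbb{Z}_3$ with $\deg(z_1)=(1,[0])$, $\deg(z_2)=(1,[2])$, $\deg(z_3)=(1,[1])$; quasi-homogeneous means homogeneous for this grading. For a degree $\alpha\in\mathbb{Z}\oplus\mathbb{Z}_3$, $(\alpha)_1\in\mathbb{Z}$ is its first coordinate. The radial vector field is $R=z_1\frac{\partial}{\partial z_1}+z_2\frac{\partial}{\partial z_2}+z_3\frac{\partial}{\partial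 z_3}$. A one-dimensional holomorphic foliation $\mathcal{F}$ of degree $\deg(\mathcal{F})\in\mathbb{Z}\oplus\mathbb{Z}_3$ is a global section of $\mathcal{T}\mathbb{P}_{\Delta(0,2,1)}\otimes\mathcal{O}_{\mathbb{P}_{\Delta(0,2,1)}}(\deg(\mathcal{F}))$ (with $\mathcal{T}$ the Zariski tangent sheaf) whose singular set has codimension at least $2$. Only foliations are considered that are induced by a quasi-homogeneous vector field $X=\sum_{i=1}^3P_i\frac{\partial}{\partial z_i}$, with $P_i$ quasi-homogeneous of degree $\deg(\mathcal{F})+\deg(z_i)$; $X$ is determined modulo multiples $gR$ with $g\in\mathrm{S}$, and $\mathrm{Sing}(\mathcal{F})$ is the image of $\{R\wedge X=0\}$ (in particular $X$ is not of the form $gR$). For a nonconstant quasi-homogeneous $f$, the hypersurface $V=\{f=0\}$ has degree $\deg(V)=\deg(f)$; it is quasi-smooth if $\{f=0\}$ is smooth on $\mathbb{C}^3\setminus\{0\}$, i.e. $f$ and all its partial derivatives have no common zero there. $V$ is invariant by $\mathcal{F}$ if $X(f)=g\cdot f$ for some quasi-homogeneous polynomial $g$. *)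

theory Defs
  imports "HOL-Analysis.Analysis" "HOL-Computational_Algebra.Polynomial"
begin

section \<open>The homogeneous coordinate ring\<close>

text \<open>The ring \<open>S = \<complex>[z\<^sub>1,z\<^sub>2,z\<^sub>3]\<close> is realised as \<open>\<complex>[z\<^sub>1][z\<^sub>2][z\<^sub>3]\<close>: the outermost variable is \<open>z\<^sub>3\<close>.
  Triples are indexed by the three-element type \<^typ>\<open>3\<close>; note that \<open>3 = 0\<close> in this type.\<close>

type_synonym S = "complex poly poly poly"

definition coords :: "S ^ 3" where
  "coords = vector [ [:[:[:0, 1:]:]:], [:[:0, 1:]:], [:0, 1:] ]"

definition mcoeff :: "S \<Rightarrow> nat ^ 3 \<Rightarrow> complex" where
  "mcoeff f e = coeff (coeff (coeff f (e $ 3)) (e $ 2)) (e $ 1)"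

definition eval :: "S \<Rightarrow> complex ^ 3 \<Rightarrow> complex" where
  "eval f z = poly (poly (poly f [:[:z $ 3:]:]) [:z $ 2:]) (z $ 1)"

definition grad :: "S \<Rightarrow> S ^ 3" where
  "grad f = vector [map_poly (map_poly pderiv) f, map_poly pderiv f, pderiv f]"

text \<open>In the degree group \<open>\<int> \<oplus> \<int>\<^sub>3\<close>, the type \<^typ>\<open>3\<close> of the second component is the ring of
  integers modulo 3.\<close>

type_synonym degree_group = "int \<times> 3"

definition deg_z :: "degree_group ^ 3" where
  "deg_z = vector [(1, 0), (1, 2), (1, 1)]"

definition monomial_degree :: "nat ^ 3 \<Rightarrow> degree_group" where
  "monomial_degree e = (\<Sum>i\<in>UNIV. \<Sum>_<e $ i. deg_z $ i)"

text \<open>Membership in the graded piece of degree \<open>\<alpha>\<close>; in particular \<open>0\<close> belongs to every piece.\<close>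

definition quasi_homogeneous :: "degree_group \<Rightarrow> S \<Rightarrow> bool" where
  "quasi_homogeneous \<alpha> f \<longleftrightarrow> (\<forall>e. mcoeff f e \<noteq> 0 \<longrightarrow> monomial_degree e = \<alpha>)"


section \<open>The toric surface with its Zariski topology\<close>

definition act :: "complex \<Rightarrow> complex \<Rightarrow> complex ^ 3 \<Rightarrow> complex ^ 3" where
  "act t w z = vector [t * w * z $ 1, t * z $ 2, t * w^2 * z $ 3]"

definition orbit :: "complex ^ 3 \<Rightarrow> (complex ^ 3) set" where
  "orbit z = {act t w z | t w. t \<noteq> 0 \<and> w ^ 3 = 1}"

text \<open>The points of the surface are the orbits of nonzero vectors. The basic open sets are the
  complements of the zero loci of quasi-homogeneous polynomials.\<close>

definition zariski :: "(complex ^ 3) set topology" where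
  "zariski = topology_generated_by
     {orbit ` {z. z \<noteq> 0 \<and> eval h z \<noteq> 0} | h. \<exists>\<alpha>. quasi_homogeneous \<alpha> h}"

definition irreducible_closed :: "'a topology \<Rightarrow> 'a set \<Rightarrow> bool" where
  "irreducible_closed T Y \<longleftrightarrow> closedin T Y \<and> Y \<noteq> {} \<and>
     (\<forall>A B. closedin T A \<and> closedin T B \<and> Y = A \<union> B \<longrightarrow> Y = A \<or> Y = B)"

text \<open>The codimension of a closed set \<open>Z\<close> is the infimum, over the irreducible closed subsets \<open>Y\<close>
  of \<open>Z\<close>, of the supremum of the lengths of chains of irreducible closed sets starting at \<open>Y\<close>.
  The empty set has codimension \<open>\<infinity>\<close>.\<close>

definition codimension :: "'a topology \<Rightarrow> 'a set \<Rightarrow> enat" where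
  "codimension T Z =
     (INF Y\<in>{Y. irreducible_closed T Y \<and> Y \<subseteq> Z}.
        SUP n\<in>{n. \<exists>C :: nat \<Rightarrow> 'a set. C 0 = Y \<and>
                    (\<forall>i\<le>n. irreducible_closed T (C i)) \<and> (\<forall>i<n. C i \<subset> C (Suc i))}.
          enat n)"


section \<open>Foliations and invariant hypersurfaces\<close>

text \<open>A vector field \<open>\<Sum>\<^sub>i P\<^sub>i \<partial>/\<partial>z\<^sub>i\<close> is the triple of its components \<open>P\<^sub>i\<close>.\<close>

type_synonym vector_field = "S ^ 3"

definition radial :: vector_field where
  "radial = coords"

definition apply_field :: "vector_field \<Rightarrow> S \<Rightarrow> S" where
  "apply_field X f = (\<Sum>i\<in>UNIV. X $ i * grad f $ i)"

definition quasi_homogeneous_field :: "degree_group \<Rightarrow> vector_field \<Rightarrow> bool" where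
  "quasi_homogeneous_field \<alpha> X \<longleftrightarrow> (\<forall>i. quasi_homogeneous (\<alpha> + deg_z $ i) (X $ i))"

text \<open>The coefficients of \<open>R \<and> X\<close> are the \<open>2 \<times> 2\<close> minors below.\<close>

definition Sing :: "vector_field \<Rightarrow> (complex ^ 3) set set" where
  "Sing X = orbit ` {z. z \<noteq> 0 \<and>
     (\<forall>i j. eval (radial $ i * X $ j - radial $ j * X $ i) z = 0)}"

text \<open>A foliation of degree \<open>\<alpha>\<close> is the set of all quasi-homogeneous fields inducing it: a class
  modulo the multiples \<open>gR\<close> with \<open>g\<close> of degree \<open>\<alpha>\<close>. The singular set does not depend on the
  representative \<open>X\<close>, since \<open>R \<and> (X + gR) = R \<and> X\<close>.\<close>

definition foliation :: "degree_group \<Rightarrow> vector_field set \<Rightarrow> bool" where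
  "foliation \<alpha> \<F> \<longleftrightarrow>
     (\<exists>X. quasi_homogeneous_field \<alpha> X \<and>
          \<F> = {X + g *s radial | g. quasi_homogeneous \<alpha> g} \<and>
          codimension zariski (Sing X) \<ge> 2)"

text \<open>A hypersurface \<open>V = {f = 0}\<close> is given by its equation; its degree is that of \<open>f\<close>.\<close>

definition hypersurface :: "degree_group \<Rightarrow> S \<Rightarrow> bool" where
  "hypersurface \<beta> f \<longleftrightarrow> quasi_homogeneous \<beta> f \<and> (\<nexists>c. f = [:[:[:c:]:]:])"

definition quasi_smooth :: "S \<Rightarrow> bool" where
  "quasi_smooth f \<longleftrightarrow> \<not> (\<exists>z. z \<noteq> 0 \<and> eval f z = 0 \<and> (\<forall>i. eval (grad f $ i) z = 0))"

definition invariant_by :: "vector_field \<Rightarrow> S \<Rightarrow> bool" where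
  "invariant_by X f \<longleftrightarrow> (\<exists>g \<gamma>. quasi_homogeneous \<gamma> g \<and> apply_field X f = g * f)"

end

theory Submission
  imports Defs "HOL-Computational_Algebra.Polynomial_Factorial"
    "HOL-Computational_Algebra.Field_as_Ring"
    "HOL-Computational_Algebra.Fundamental_Theorem_Algebra"
begin

text \<open>
  Forget the \<open>\<int>\<^sub>3\<close> part of the grading: \<open>f\<close> is an ordinary form of some degree \<open>n > 0\<close>, and a field
  \<open>Y\<close> representing the foliation has components of degree \<open>e = (\<alpha>)\<^sub>1 + 1\<close>. If \<open>Y f = g f\<close>, then Euler's
  identity \<open>R f = n f\<close> shows that \<open>Q = n Y - g R\<close> annihilates \<open>f\<close>, so that \<open>Q\<close> is a syzygy of the
  partial derivatives of \<open>f\<close>, with entries of degree \<open>e\<close>. It is not zero: otherwise \<open>Y\<close> would be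
  proportional to \<open>R\<close>, the singular set would be the whole surface, and the surface, being
  irreducible, has codimension \<open>0\<close> in itself.

  By Euler's identity again, quasi-smoothness says that the three partial derivatives, of degree
  \<open>m = n - 1\<close>, have no common zero besides the origin. They then form a regular sequence, all their
  syzygies are combinations of the Koszul ones, and a nonzero syzygy has entries of degree at
  least \<open>m\<close>. Hence \<open>n - 1 \<le> e\<close>, which is the claim.

  The bound on syzygies (\<open>syzygy_eq_0\<close>) is obtained without the theory of regular sequences. Let
  \<open>A p + B q + C r = 0\<close> with \<open>p, q, r\<close> forms of degree \<open>m\<close> without common zero, and \<open>A, B, C\<close> forms of degree
  \<open>e < m\<close>. After a permutation \<open>p\<close> does not vanish at \<open>(0, 1, 0)\<close>. Suppose that \<open>p\<close> and \<open>q\<close> have no common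
  zero on the line \<open>z\<^sub>3 = 0\<close>. A Nullstellensatz for
  the chart \<open>z\<^sub>3 = 1\<close> (\<open>plane_nullstellensatz\<close>) and homogeneity give \<open>z\<^sub>3\<^sup>N \<in> (p, q, r)\<close>. Multiplying by
  \<open>C\<close> and using the syzygy, \<open>z\<^sub>3\<^sup>N C \<in> (p, q)\<close>. The factors \<open>z\<^sub>3\<close> can be cancelled one by one, because
  the restrictions of \<open>p\<close> and \<open>q\<close> to the line are coprime binary forms (\<open>z3_cancel\<close>). So
  \<open>C \<in> (p, q)\<close>, and \<open>C = 0\<close> as its degree is less than \<open>m\<close>. To reach the general case, replace
  \<open>q\<close> by \<open>q + a r\<close>, which turns \<open>C\<close> into \<open>C - a B\<close>: for all but finitely many \<open>a\<close> the extra assumption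
  holds, and \<open>C = a B\<close> for two different values of \<open>a\<close> forces \<open>B = C = 0\<close>.
\<close>

section \<open>Ideals with three generators\<close>

definition ideal3 :: "'a::comm_ring_1 \<Rightarrow> 'a \<Rightarrow> 'a \<Rightarrow> 'a set" where
  "ideal3 p q r = {a * p + b * q + c * r | a b c. True}"

lemma ideal3I: "x = a * p + b * q + c * r \<Longrightarrow> x \<in> ideal3 p q r"
  unfolding ideal3_def by blast

lemma ideal3_gens: "p \<in> ideal3 p q r" "q \<in> ideal3 p q r" "r \<in> ideal3 p q r"
  by (rule ideal3I[of _ 1 _ 0 _ 0], simp)
     (rule ideal3I[of _ 0 _ 1 _ 0], simp, rule ideal3I[of _ 0 _ 0 _ 1], simp)

lemma ideal3_0: "0 \<in> ideal3 p q r"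
  by (rule ideal3I[of _ 0 _ 0 _ 0]) simp

lemma ideal3_add: "x \<in> ideal3 p q r \<Longrightarrow> y \<in> ideal3 p q r \<Longrightarrow> x + y \<in> ideal3 p q r"
proof -
  assume "x \<in> ideal3 p q r" "y \<in> ideal3 p q r"
  then obtain a b c a' b' c' where "x = a * p + b * q + c * r" "y = a' * p + b' * q + c' * r"
    unfolding ideal3_def by blast
  then have "x + y = (a + a') * p + (b + b') * q + (c + c') * r"
    by (simp add: algebra_simps)
  then show ?thesis by (rule ideal3I)
qed

lemma ideal3_mult: "x \<in> ideal3 p q r \<Longrightarrow> y * x \<in> ideal3 p q r"
proof -
  assume "x \<in> ideal3 p q r"
  then obtain a b c where "x = a * p + b * q + c * r"
    unfolding ideal3_def by blast
  then have "y * x = (y * a) * p + (y * b) * q + (y * c) * r"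
    by (simp add: algebra_simps)
  then show ?thesis by (rule ideal3I)
qed

lemma ideal3_diff: "x \<in> ideal3 p q r \<Longrightarrow> y \<in> ideal3 p q r \<Longrightarrow> x - y \<in> ideal3 p q r"
  using ideal3_add[of x p q r "(-1) * y"] ideal3_mult[of y p q r "-1"] by simp

section \<open>Nullstellensatz and coprimality for polynomials in two variables\<close>

text \<open>In \<open>\<complex>[u][v]\<close> the outer variable is \<open>v\<close>; a leading coefficient is thus an element of \<open>\<complex>[u]\<close>, and if it
  is a unit then the number of zeros above each abscissa \<open>u\<close>, with multiplicity, does not depend
  on \<open>u\<close>.\<close>

abbreviation eval2 :: "complex poly poly \<Rightarrow> complex \<Rightarrow> complex \<Rightarrow> complex" where
  "eval2 t u v \<equiv> poly (poly t [:v:]) u"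

abbreviation slice :: "complex \<Rightarrow> complex poly poly \<Rightarrow> complex poly" where
  "slice u \<equiv> map_poly (\<lambda>c. poly c u)"

lemma poly_slice: "poly (slice u t) v = eval2 t u v"
  by (induction t) (simp_all add: map_poly_pCons)

lemma slice_eq_iff_dvd: "slice u s = slice u t \<longleftrightarrow> [:[:-u, 1:]:] dvd s - t"
  by (auto simp: const_poly_dvd_iff poly_eq_iff coeff_map_poly poly_eq_0_iff_dvd[symmetric])

lemma degree_slice: "is_unit (lead_coeff t) \<Longrightarrow> degree (slice u t) = degree t"
  by (cases "t = 0") (auto simp: is_unit_poly_iff intro!: map_poly_degree_eq)

lemma unit_lead_coeff_dvd:
  fixes p t :: "complex poly poly"
  assumes "is_unit (lead_coeff t)" "p dvd t"
  shows "is_unit (lead_coeff p)"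
proof -
  obtain s where "t = p * s" using assms(2) by (auto elim: dvdE)
  then have "lead_coeff p * lead_coeff s dvd 1" using assms(1) by (simp add: lead_coeff_mult)
  then show ?thesis by (rule dvd_mult_left)
qed

text \<open>A divisor of a polynomial that is monic in \<open>v\<close> is itself monic in \<open>v\<close> up to a constant. Unless it
  is a unit it has positive degree in \<open>v\<close>, and specialising \<open>u\<close> does not lower that degree.\<close>

lemma zero_over_each_abscissa:
  fixes p t :: "complex poly poly"
  assumes "is_unit (lead_coeff t)" "p dvd t" "\<not> is_unit p"
  shows "\<exists>v. eval2 p u v = 0"
proof -
  have lc: "is_unit (lead_coeff p)" using unit_lead_coeff_dvd assms by blast
  have "degree p > 0"
  proof (rule ccontr)
    assume "\<not> degree p > 0"
    then obtain c where "p = [:c:]" using degree_eq_zeroE by blast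
    with lc assms(3) show False by (simp add: is_unit_const_poly_iff)
  qed
  then have "degree (slice u p) \<noteq> 0" using degree_slice[OF lc] by simp
  then obtain v where "poly (slice u p) v = 0"
    using fundamental_theorem_of_algebra_alt[of "slice u p"] by fastforce
  then show ?thesis by (auto simp: poly_slice)
qed

lemma bezout_complex_poly:
  fixes p q r :: "complex poly"
  assumes "p \<noteq> 0" and nz: "\<And>v. \<not> (poly p v = 0 \<and> poly q v = 0 \<and> poly r v = 0)"
  shows "1 \<in> ideal3 p q r"
proof -
  define d where "d = gcd p (gcd q r)"
  define e where "e = gcd q r"
  obtain x y where e: "x * q + y * r = e" unfolding e_def using bezout_coefficients_fst_snd by blast
  obtain z w where d: "z * p + w * e = d" unfolding e_def d_def using bezout_coefficients_fst_snd by blast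
  have dI: "d \<in> ideal3 p q r"
    by (rule ideal3I[of _ z _ "w * x" _ "w * y"]) (simp add: d[symmetric] e[symmetric] algebra_simps)
  have "degree d = 0"
  proof (rule ccontr)
    assume "degree d \<noteq> 0"
    then obtain v where v: "poly d v = 0"
      using fundamental_theorem_of_algebra_alt[of d] by fastforce
    have "d dvd p" "d dvd q" "d dvd r" unfolding d_def by (auto intro: dvd_trans)
    with v have "poly p v = 0 \<and> poly q v = 0 \<and> poly r v = 0"
      by (auto elim!: dvdE)
    with nz show False by blast
  qed
  moreover have "d \<noteq> 0" using assms(1) by (simp add: d_def)
  ultimately have "is_unit d" by (metis is_unit_iff_degree)
  then obtain k where "1 = k * d" by (metis dvd_def mult.commute)
  then show ?thesis using ideal3_mult[OF dI, of k] by simp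
qed

text \<open>Gauss's lemma: constants multiplied to \<open>f\<close> cannot account for a primitive divisor.\<close>

lemma primitive_part_dvd_of_smult:
  fixes f r q :: "'a :: {factorial_ring_gcd, semiring_gcd_mult_normalize} poly"
  assumes "a \<noteq> 0" "smult a f = r * q"
  shows "primitive_part r dvd f"
proof -
  have u: "is_unit (unit_factor a)" using assms(1) by simp
  have "smult (unit_factor a) (primitive_part f) = primitive_part r * primitive_part q"
    using assms(2) by (metis primitive_part_smult primitive_part_mult)
  then have "primitive_part r dvd smult (unit_factor a) (primitive_part f)" by simp
  also have "smult (unit_factor a) (primitive_part f) = primitive_part f * [:unit_factor a:]"
    by (simp add: mult.commute)
  finally have "primitive_part r dvd primitive_part f"
    using u by (subst (asm) dvd_mult_unit_iff) (simp_all add: is_unit_const_poly_iff)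
  then show ?thesis
    by (metis content_times_primitive_part dvd_smult)
qed

text \<open>Over the fraction field of \<open>'a\<close> the ideal is generated by an element \<open>s\<close> of least degree in it, as
  pseudo-division by \<open>s\<close> leaves no remainder. By Gauss's lemma the primitive part of \<open>s\<close> is a common
  divisor of the generators, so \<open>s\<close> is constant.\<close>

lemma elimination:
  fixes p q r :: "'a :: {factorial_ring_gcd, semiring_gcd_mult_normalize} poly"
  assumes "p \<noteq> 0"
    and nc: "\<And>g. g dvd p \<Longrightarrow> g dvd q \<Longrightarrow> g dvd r \<Longrightarrow> degree g = 0"
  shows "\<exists>\<rho>. \<rho> \<noteq> 0 \<and> [:\<rho>:] \<in> ideal3 p q r"
proof -
  define J where "J = ideal3 p q r"
  define s where "s = arg_min degree (\<lambda>s. s \<in> J \<and> s \<noteq> 0)"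
  have "p \<in> J \<and> p \<noteq> 0" using assms(1) ideal3_gens by (auto simp: J_def)
  then have s: "s \<in> J" "s \<noteq> 0" and min: "\<And>t. t \<in> J \<Longrightarrow> t \<noteq> 0 \<Longrightarrow> degree s \<le> degree t"
    using arg_min_nat_lemma[of "\<lambda>s. s \<in> J \<and> s \<noteq> 0" p degree] unfolding s_def by auto
  have dv: "primitive_part s dvd f" if "f \<in> J" for f
  proof -
    obtain a h where a: "a \<noteq> 0" "smult a f = s * h + pseudo_mod f s"
      using pseudo_mod(1)[OF s(2), of f] by blast
    have "pseudo_mod f s = [:a:] * f - h * s" using a(2) by (simp add: algebra_simps)
    then have "pseudo_mod f s \<in> J"
      using that s(1) ideal3_diff ideal3_mult unfolding J_def by metis
    then have "pseudo_mod f s = 0"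
      using min pseudo_mod(2)[OF s(2), of f] by (metis leD)
    with a show ?thesis using primitive_part_dvd_of_smult by (metis add.right_neutral)
  qed
  have "degree (primitive_part s) = 0"
    by (rule nc) (auto intro!: dv simp: J_def ideal3_gens)
  then have "degree s = 0" by simp
  then obtain \<rho> where "s = [:\<rho>:]" using degree_eq_zeroE by blast
  with s show ?thesis by (auto simp: J_def)
qed

text \<open>Elimination yields a nonzero \<open>\<rho>(u)\<close> in the ideal; take it of least degree. A root \<open>u\<close> of \<open>\<rho>\<close> can be
  removed: over this \<open>u\<close> the three polynomials in \<open>v\<close> have no common zero, hence generate \<open>1\<close>, and
  multiplying that relation by \<open>\<rho>\<close> divided by its linear factor gives a smaller element of the
  ideal. So \<open>\<rho>\<close> is constant. Monicity of \<open>p\<close> rules out a common factor of the three polynomials and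
  keeps \<open>p\<close> nonzero over each \<open>u\<close>.\<close>

theorem plane_nullstellensatz:
  fixes p q r :: "complex poly poly"
  assumes lc: "is_unit (lead_coeff p)"
    and nz: "\<And>u v. \<not> (eval2 p u v = 0 \<and> eval2 q u v = 0 \<and> eval2 r u v = 0)"
  shows "1 \<in> ideal3 p q r"
proof -
  define J where "J = ideal3 p q r"
  have p0: "p \<noteq> 0" using lc by auto
  have "\<exists>\<rho>. \<rho> \<noteq> 0 \<and> [:\<rho>:] \<in> J" unfolding J_def
  proof (rule elimination[OF p0])
    fix g assume g: "g dvd p" "g dvd q" "g dvd r"
    have "is_unit g"
    proof (rule ccontr)
      assume "\<not> is_unit g"
      then obtain v where "eval2 g 0 v = 0" using zero_over_each_abscissa lc g(1) by blast
      then have "eval2 p 0 v = 0 \<and> eval2 q 0 v = 0 \<and> eval2 r 0 v = 0"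
        using g by (auto elim!: dvdE)
      with nz show False by blast
    qed
    then show "degree g = 0" by (auto simp: is_unit_poly_iff)
  qed
  then obtain \<rho>0 where r0: "[:\<rho>0:] \<in> J \<and> \<rho>0 \<noteq> 0" by blast
  define \<rho> where "\<rho> = arg_min degree (\<lambda>s. [:s:] \<in> J \<and> s \<noteq> 0)"
  have rho: "[:\<rho>:] \<in> J" "\<rho> \<noteq> 0" and min: "\<And>t. [:t:] \<in> J \<Longrightarrow> t \<noteq> 0 \<Longrightarrow> degree \<rho> \<le> degree t"
    using arg_min_nat_lemma[of "\<lambda>s. [:s:] \<in> J \<and> s \<noteq> 0" \<rho>0 degree] r0 unfolding \<rho>_def by auto
  have "degree \<rho> = 0"
  proof (rule ccontr)
    assume "degree \<rho> \<noteq> 0"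
    then obtain u where "poly \<rho> u = 0"
      using fundamental_theorem_of_algebra_alt[of \<rho>] by fastforce
    then obtain \<sigma> where \<sigma>: "\<rho> = [:-u, 1:] * \<sigma>" by (auto simp: poly_eq_0_iff_dvd elim: dvdE)
    have \<sigma>0: "\<sigma> \<noteq> 0" "degree \<sigma> < degree \<rho>" using rho(2) \<sigma> by (auto simp: degree_mult_eq simp del: mult_pCons_left)
    have "slice u p \<noteq> 0"
    proof
      assume "slice u p = 0"
      then have "poly (coeff p (degree p)) u = 0"
        by (metis coeff_0 coeff_map_poly poly_0)
      with lc show False by (auto simp: is_unit_poly_iff)
    qed
    then have "1 \<in> ideal3 (slice u p) (slice u q) (slice u r)"
      using bezout_complex_poly nz by (simp add: poly_slice)
    then obtain a b c where abc: "1 = a * slice u p + b * slice u q + c * slice u r"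
      unfolding ideal3_def by blast
    \<comment> \<open>Coefficients of the relation over the single abscissa \<open>u\<close>, extended constantly in \<open>u\<close>.\<close>
    define L where "L = map_poly (\<lambda>x::complex. [:x:])"
    define h where "h = L a * p + L b * q + L c * r"
    have evL: "eval2 (L a) u v = poly a v" for a v
      unfolding L_def by (induction a) (simp_all add: map_poly_pCons)
    have "slice u h = slice u 1"
    proof (rule poly_eq_poly_eq_iff[THEN iffD1], rule ext)
      fix v
      have "poly (slice u h) v = poly (a * slice u p + b * slice u q + c * slice u r) v"
        unfolding poly_slice h_def by (simp add: evL poly_slice)
      then show "poly (slice u h) v = poly (slice u 1) v"
        using abc by (simp add: poly_slice)
    qed
    then obtain s where s: "h - 1 = [:[:-u, 1:]:] * s" unfolding slice_eq_iff_dvd by (rule dvdE)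
    have hJ: "h \<in> J" unfolding J_def h_def by (rule ideal3I) simp
    have "[:\<sigma>:] * [:[:-u,1:]:] = [:\<rho>:]" by (simp add: \<sigma> mult.commute)
    then have "[:\<sigma>:] * (h - 1) = s * [:\<rho>:]" unfolding s by (metis mult.assoc mult.commute)
    moreover have "[:\<sigma>:] * (h - 1) = [:\<sigma>:] * h - [:\<sigma>:]"
      by (simp only: right_diff_distrib mult_1_right)
    ultimately have "[:\<sigma>:] = [:\<sigma>:] * h - s * [:\<rho>:]"
      by (metis add_diff_cancel_right' diff_add_cancel add.commute)
    then have "[:\<sigma>:] \<in> J"
      using hJ rho(1) ideal3_diff ideal3_mult unfolding J_def by metis
    with min \<sigma>0 show False by (metis leD)
  qed
  then obtain k where "\<rho> = [:k:]" using degree_eq_zeroE by blast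
  then have "k \<noteq> 0" "[:[:k:]:] \<in> J" using rho by auto
  then have "[:[:1/k:]:] * [:[:k:]:] \<in> J" using ideal3_mult unfolding J_def by blast
  then show ?thesis using \<open>k \<noteq> 0\<close> by (simp add: J_def one_pCons)
qed

text \<open>For binary forms, having no common zero with \<open>u = 1\<close> already means being coprime when one of them is
  monic in \<open>v\<close>: a common factor would have a zero above every abscissa.\<close>

lemma binary_koszul:
  fixes p q A B :: "complex poly poly"
  assumes lc: "is_unit (lead_coeff p)"
    and nz: "\<And>v. \<not> (eval2 p 1 v = 0 \<and> eval2 q 1 v = 0)"
    and eq: "A * p + B * q = 0"
  shows "\<exists>C. A = C * q \<and> B = - (C * p)"
proof -
  have "coprime p q"
  proof (rule coprimeI)
    fix g assume g: "g dvd p" "g dvd q"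
    show "is_unit g"
    proof (rule ccontr)
      assume "\<not> is_unit g"
      then obtain v where "eval2 g 1 v = 0" using zero_over_each_abscissa lc g(1) by blast
      then have "eval2 p 1 v = 0 \<and> eval2 q 1 v = 0" using g by (auto elim!: dvdE)
      with nz show False by blast
    qed
  qed
  moreover have BA: "B * q = (- A) * p" using eq by (simp add: eq_neg_iff_add_eq_0 add.commute)
  then have "p dvd B * q" by simp
  ultimately have "p dvd B" by (simp add: coprime_dvd_mult_left_iff)
  then obtain C where C: "B = p * C" by (auto elim: dvdE)
  have "p \<noteq> 0" using lc by auto
  moreover have "p * (A + C * q) = 0" using BA C by (simp add: algebra_simps)
  ultimately have "A + C * q = 0" by simp
  then show ?thesis using C by (intro exI[of _ "-C"]) (simp add: eq_neg_iff_add_eq_0)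
qed


section \<open>Forms in three variables\<close>

text \<open>If \<open>D\<close> sends an element of the coefficient ring to the polynomial in \<open>s\<close> whose coefficients are its
  homogeneous components, then \<open>dilate D\<close> does the same one variable up: it applies \<open>D\<close> to the
  coefficients and substitutes \<open>s x\<close> for the new variable \<open>x\<close>.\<close>

definition dilate :: "('a::comm_ring_1 \<Rightarrow> 'a poly) \<Rightarrow> 'a poly \<Rightarrow> 'a poly poly" where
  "dilate D p = poly (map_poly (\<lambda>c. map_poly (\<lambda>x. [:x:]) (D c)) p) (monom [:0, 1:] 1)"

definition ring_morphism :: "('a::comm_ring_1 \<Rightarrow> 'b::comm_ring_1) \<Rightarrow> bool" where
  "ring_morphism D \<longleftrightarrow> D 1 = 1 \<and> (\<forall>x y. D (x + y) = D x + D y) \<and> (\<forall>x y. D (x * y) = D x * D y)"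

lemma ring_morphismD:
  assumes "ring_morphism D"
  shows "D 1 = 1" "D (x + y) = D x + D y" "D (x * y) = D x * D y" "D 0 = 0" "D (x - y) = D x - D y"
proof -
  show *: "D 1 = 1" "D (x + y) = D x + D y" "D (x * y) = D x * D y" for x y
    using assms by (auto simp: ring_morphism_def)
  show "D 0 = 0" using *(2)[of 0 0] by simp
  show "D (x - y) = D x - D y" using *(2)[of "x - y" y] by simp
qed

lemma ring_morphism_const: "ring_morphism (\<lambda>c. [:c:])"
  by (simp add: ring_morphism_def one_pCons)

lemma ring_morphism_poly_map_poly:
  assumes D: "ring_morphism D"
  shows "ring_morphism (\<lambda>p. poly (map_poly D p) a)"
proof -
  note D = ring_morphismD[OF D]
  define E where "E = (\<lambda>p. poly (map_poly D p) a)"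
  have E: "E 0 = 0" "E (pCons c p) = D c + a * E p" for c p
    by (simp_all add: E_def map_poly_pCons D)
  have add: "E (p + q) = E p + E q" for p q
    by (induction p q rule: poly_induct2) (simp_all add: E D algebra_simps)
  have sm: "E (smult c p) = D c * E p" for c p
    by (induction p) (simp_all add: E D algebra_simps)
  have "E (p * q) = E p * E q" for p q
    by (induction p) (simp_all add: E D algebra_simps add sm)
  moreover have "E 1 = 1" by (simp add: one_pCons E D)
  ultimately show ?thesis using add unfolding ring_morphism_def E_def by blast
qed

lemma ring_morphism_map_poly:
  assumes D: "ring_morphism D"
  shows "ring_morphism (map_poly D)"
proof -
  note D = ring_morphismD[OF D]
  have add: "map_poly D (p + q) = map_poly D p + map_poly D q" for p q
    by (simp add: poly_eq_iff coeff_map_poly D)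
  have sm: "map_poly D (smult c p) = smult (D c) (map_poly D p)" for c p
    by (simp add: poly_eq_iff coeff_map_poly D)
  have "map_poly D (p * q) = map_poly D p * map_poly D q" for p q
    by (induction p) (simp_all add: map_poly_pCons D add sm)
  then show ?thesis using add by (simp add: ring_morphism_def D one_pCons map_poly_pCons)
qed

lemma ring_morphism_dilate:
  assumes D: "ring_morphism D"
  shows "ring_morphism (dilate D)"
proof -
  have "ring_morphism (\<lambda>c. map_poly (\<lambda>x. [:x:]) (D c))"
    unfolding ring_morphism_def
    by (simp add: ring_morphismD[OF D] ring_morphismD[OF ring_morphism_map_poly[OF ring_morphism_const]])
  from ring_morphism_poly_map_poly[OF this] show ?thesis by (simp add: dilate_def [abs_def])
qed

lemma coeff_dilate:
  assumes D: "ring_morphism D"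
  shows "coeff (coeff (dilate D p) n) k = (if k \<le> n then coeff (D (coeff p k)) (n - k) else 0)"
proof (induction p arbitrary: n k)
  case 0
  show ?case using ring_morphismD(4)[OF D] by (simp add: dilate_def)
next
  case (pCons c p)
  have "dilate D (pCons c p) = map_poly (\<lambda>x. [:x:]) (D c) + monom [:0, 1:] 1 * dilate D p"
    by (simp add: dilate_def map_poly_pCons ring_morphismD[OF D])
  then have "coeff (coeff (dilate D (pCons c p)) n) k =
    coeff [:coeff (D c) n:] k + (if n = 0 then 0 else coeff (pCons 0 (coeff (dilate D p) (n - 1))) k)"
    by (simp add: coeff_map_poly coeff_monom_mult)
  then show ?case
    by (auto simp: pCons.IH coeff_pCons ring_morphismD[OF D] split: nat.splits)
qed

text \<open>The map \<open>f \<mapsto> f(s z\<^sub>1, s z\<^sub>2, s z\<^sub>3)\<close>. As it is a ring morphism, the component of degree \<open>n\<close> of a product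
  can be read off as a coefficient of a product of polynomials in \<open>s\<close>.\<close>

definition dil :: "S \<Rightarrow> S poly" where
  "dil = dilate (dilate (dilate (\<lambda>c. [:c:])))"

lemma ring_morphism_dil: "ring_morphism dil"
  unfolding dil_def by (intro ring_morphism_dilate ring_morphism_const)

lemmas dil_simps = ring_morphismD[OF ring_morphism_dil]

lemma coeff_dil:
  "coeff (coeff (coeff (coeff (dil f) n) k) j) i =
     (if n = i + j + k then coeff (coeff (coeff f k) j) i else 0)"
  unfolding dil_def
  by (simp add: coeff_dilate ring_morphism_dilate ring_morphism_const)
     (auto simp: coeff_pCons split: nat.splits)

definition homogeneous :: "nat \<Rightarrow> S \<Rightarrow> bool" where
  "homogeneous n f \<longleftrightarrow> dil f = monom f n"

lemma homogeneous_iff: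
  "homogeneous n f \<longleftrightarrow> (\<forall>i j k. coeff (coeff (coeff f k) j) i \<noteq> 0 \<longrightarrow> i + j + k = n)"
  unfolding homogeneous_def by (auto simp: poly_eq_iff coeff_dil)

lemma homogeneous_add: "homogeneous n f \<Longrightarrow> homogeneous n g \<Longrightarrow> homogeneous n (f + g)"
  by (simp add: homogeneous_def dil_simps add_monom)

lemma homogeneous_diff: "homogeneous n f \<Longrightarrow> homogeneous n g \<Longrightarrow> homogeneous n (f - g)"
  by (simp add: homogeneous_def dil_simps diff_monom)

lemma homogeneous_mult: "homogeneous m f \<Longrightarrow> homogeneous n g \<Longrightarrow> homogeneous (m + n) (f * g)"
  by (simp add: homogeneous_def dil_simps mult_monom)

lemma homogeneous_cancel:
  assumes "homogeneous n f" "f \<noteq> 0" "homogeneous (m + n) (g * f)"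
  shows "homogeneous m g"
proof -
  have "dil g * monom f n = monom g m * monom f n"
    using assms by (simp add: homogeneous_def dil_simps mult_monom)
  then show ?thesis using assms(2) by (simp add: homogeneous_def)
qed

abbreviation const3 :: "complex \<Rightarrow> S" where "const3 c \<equiv> [:[:[:c:]:]:]"

lemma homogeneous_const: "homogeneous 0 (const3 c)"
  by (auto simp: homogeneous_iff coeff_pCons split: nat.splits)

lemma homogeneous_smult: "homogeneous n f \<Longrightarrow> homogeneous n (const3 c * f)"
  using homogeneous_mult[OF homogeneous_const] by force

lemma homogeneous_in_ideal:
  assumes p: "homogeneous m p" "homogeneous m q" and g: "homogeneous e g" and "e < m"
    and eq: "g = A * p + B * q"
  shows "g = 0"
proof -
  have "coeff (dil g) e = coeff (dil A * monom p m + dil B * monom q m) e"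
    using p by (simp add: eq dil_simps homogeneous_def)
  also have "\<dots> = 0" using \<open>e < m\<close> by (simp add: mult.commute[of _ "monom _ _"] coeff_monom_mult)
  finally show ?thesis using g by (simp add: homogeneous_def)
qed

abbreviation z3 :: S where "z3 \<equiv> [:0, 1:]"

text \<open>The relation in the chart says that \<open>1 + (z\<^sub>3 - 1) t\<close> lies in the ideal \<open>I\<close> for some \<open>t\<close>. As \<open>I\<close> is
  homogeneous, its dilation \<open>1 + (s z\<^sub>3 - 1) t(s z)\<close> has all its coefficients in \<open>I\<close>. So modulo \<open>I\<close>
  the polynomial \<open>t(s z)\<close> in \<open>s\<close> is the geometric series \<open>\<Sum>\<^sub>k z\<^sub>3\<^sup>k s\<^sup>k\<close>; being a polynomial, it
  forces \<open>z\<^sub>3\<^sup>k \<in> I\<close> for large \<open>k\<close>.\<close>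

lemma z3_power_in_ideal:
  assumes hom: "homogeneous m p" "homogeneous m q" "homogeneous m r"
    and chart: "1 \<in> ideal3 (poly p 1) (poly q 1) (poly r 1)"
  shows "\<exists>N. z3 ^ N \<in> ideal3 p q r"
proof -
  obtain a b c where abc: "1 = a * poly p 1 + b * poly q 1 + c * poly r 1"
    using chart unfolding ideal3_def by blast
  have "poly ([:a:] * p + [:b:] * q + [:c:] * r - 1) 1 = 0" using abc by simp
  then have "[:-1, 1:] dvd [:a:] * p + [:b:] * q + [:c:] * r - 1" by (simp only: poly_eq_0_iff_dvd)
  then obtain t where t: "[:a:] * p + [:b:] * q + [:c:] * r - 1 = [:-1, 1:] * t" by (rule dvdE)
  have dilz: "dil [:-1, 1:] = monom z3 1 - 1"
  proof -
    have "homogeneous 1 z3" by (auto simp: homogeneous_iff coeff_pCons split: nat.splits)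
    moreover have "[:-1, 1:] = z3 - 1" by (simp add: one_pCons)
    ultimately show ?thesis by (simp only: dil_simps homogeneous_def)
  qed
  define s where "s = dil t"
  have eq: "dil [:a:] * monom p m + dil [:b:] * monom q m + dil [:c:] * monom r m - 1 = (monom z3 1 - 1) * s"
    using arg_cong[OF t, of dil] hom unfolding homogeneous_def dil_simps dilz s_def by simp
  have inI: "coeff (dil [:a:] * monom p m + dil [:b:] * monom q m + dil [:c:] * monom r m) n \<in> ideal3 p q r" for n
  proof (cases "n < m")
    case True
    then show ?thesis by (simp add: mult.commute[of _ "monom _ _"] coeff_monom_mult ideal3_0)
  next
    case False
    then show ?thesis
      by (intro ideal3I[of _ "coeff (dil [:a:]) (n - m)" _ "coeff (dil [:b:]) (n - m)" _ "coeff (dil [:c:]) (n - m)"])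
         (simp add: mult.commute[of _ "monom _ _"] coeff_monom_mult mult.commute[of p] mult.commute[of q] mult.commute[of r])
  qed
  have eqn: "coeff (dil [:a:] * monom p m + dil [:b:] * monom q m + dil [:c:] * monom r m) n =
     coeff 1 n + (if n = 0 then 0 else z3 * coeff s (n - 1)) - coeff s n" for n
  proof -
    have "dil [:a:] * monom p m + dil [:b:] * monom q m + dil [:c:] * monom r m = 1 + monom z3 1 * s - s"
      using eq by (simp only: left_diff_distrib diff_eq_eq) simp
    then show ?thesis by (simp only: coeff_add coeff_diff coeff_monom_mult) simp
  qed
  have "z3 ^ n - coeff s n \<in> ideal3 p q r" for n
  proof (induction n)
    case 0
    show ?case using inI[of 0] unfolding eqn by simp
  next
    case (Suc n)
    have "z3 * coeff s n - coeff s (Suc n) \<in> ideal3 p q r" using inI[of "Suc n"] unfolding eqn by simp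
    from ideal3_add[OF this ideal3_mult[OF Suc, of z3]] show ?case
      by (simp only: right_diff_distrib power_Suc) (simp add: algebra_simps)
  qed
  from this[of "Suc (degree s)"] show ?thesis by (metis coeff_eq_0 lessI diff_zero)
qed

text \<open>If \<open>z\<^sub>3 g = A p + B q\<close>, then on the line \<open>z\<^sub>3 = 0\<close> the pair \<open>(A, B)\<close> is a multiple \<open>C\<close> of the Koszul
  syzygy \<open>(q, -p)\<close>. Subtracting this multiple from \<open>(A, B)\<close> keeps \<open>A p + B q\<close> and makes both coefficients
  divisible by \<open>z\<^sub>3\<close>.\<close>

lemma z3_cancel:
  assumes lc: "is_unit (lead_coeff (poly p 0))"
    and nz: "\<And>v. \<not> (eval2 (poly p 0) 1 v = 0 \<and> eval2 (poly q 0) 1 v = 0)"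
    and eq: "z3 ^ N * g = A * p + B * q"
  shows "\<exists>A B. g = A * p + B * q"
  using eq
proof (induction N arbitrary: A B)
  case 0
  then show ?case by auto
next
  case (Suc N)
  have "poly A 0 * poly p 0 + poly B 0 * poly q 0 = poly (z3 ^ Suc N * g) 0"
    unfolding Suc.prems by simp
  also have "\<dots> = 0" by simp
  finally obtain C where C: "poly A 0 = C * poly q 0" "poly B 0 = - (C * poly p 0)"
    using binary_koszul[OF lc nz] by blast
  have "z3 dvd A - [:C:] * q" "z3 dvd B + [:C:] * p"
    using C by (simp_all add: dvd_iff_poly_eq_0)
  then obtain A' B' where AB: "A - [:C:] * q = z3 * A'" "B + [:C:] * p = z3 * B'" by (elim dvdE)
  have "z3 * (z3 ^ N * g) = (A - [:C:] * q) * p + (B + [:C:] * p) * q"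
  proof -
    have "a * p + b * q = (a - c * q) * p + (b + c * p) * q" for a b c :: S
      by (simp add: algebra_simps)
    then show ?thesis using Suc.prems by (metis power_Suc mult.assoc)
  qed
  also have "\<dots> = z3 * (A' * p + B' * q)" unfolding AB by (simp only: distrib_left mult.assoc)
  finally have "z3 ^ N * g = A' * p + B' * q" by simp
  then show ?case by (rule Suc.IH)
qed

section \<open>Syzygies of forms without common zero\<close>

abbreviation pt :: "complex \<Rightarrow> complex \<Rightarrow> complex \<Rightarrow> complex ^ 3" where
  "pt x y z \<equiv> vector [x, y, z]"

lemma eval_simps [simp]:
  "eval (f + g) z = eval f z + eval g z" "eval (f * g) z = eval f z * eval g z"
  "eval (f - g) z = eval f z - eval g z" "eval 0 z = 0" "eval 1 z = 1" "eval (const3 c) z = c"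
  by (simp_all add: eval_def)

lemma eval2_chart: "eval2 (poly f 1) u v = eval f (pt u v 1)" 
  by (simp add: eval_def vector_3 one_pCons)

lemma eval2_line: "eval2 (poly f 0) u v = eval f (pt u v 0)"
  by (simp add: eval_def vector_3)

lemma pt_eq_0: "pt x y z = 0 \<longleftrightarrow> x = 0 \<and> y = 0 \<and> z = 0"
  by (simp add: vec_eq_iff forall_3 vector_3)

lemma unit_lead_coeff:
  fixes t :: "complex poly poly"
  assumes "\<And>i j. coeff (coeff t j) i \<noteq> 0 \<Longrightarrow> i + j \<le> m" "coeff (coeff t m) 0 \<noteq> 0"
  shows "is_unit (lead_coeff t)"
proof -
  have "degree t \<le> m"
    using assms(1) by (intro degree_le) (force simp: poly_eq_iff)
  moreover have "coeff t m \<noteq> 0" using assms(2) by auto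
  ultimately have d: "degree t = m" using le_degree by fastforce
  have "coeff t m = [:coeff (coeff t m) 0:]"
  proof (rule poly_eqI)
    fix i show "coeff (coeff t m) i = coeff [:coeff (coeff t m) 0:] i"
      using assms(1)[of m i] by (cases i) auto
  qed
  then show ?thesis using assms(2) d by (metis dvd_field_iff is_unit_const_poly_iff)
qed

text \<open>A form not vanishing at \<open>(0, 1, 0)\<close> contains a pure power of \<open>z\<^sub>2\<close>, which stays its leading term in
  \<open>z\<^sub>2\<close> both on the line \<open>z\<^sub>3 = 0\<close> and in the chart \<open>z\<^sub>3 = 1\<close>.\<close>

lemma unit_lead_coeff_slices:
  assumes hom: "homogeneous m p" and p0: "eval p (pt 0 1 0) \<noteq> 0"
  shows "is_unit (lead_coeff (poly p 0))" "is_unit (lead_coeff (poly p 1))"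
proof -
  have h: "coeff (coeff (coeff p k) j) i \<noteq> 0 \<Longrightarrow> i + j + k = m" for i j k
    using hom by (auto simp: homogeneous_iff)
  define t where "t = coeff p 0"
  have "poly (poly t 1) 0 \<noteq> 0" using p0 by (simp add: eval_def vector_3 t_def poly_0_coeff_0 one_pCons)
  then have "(\<Sum>j\<le>degree t. coeff (coeff t j) 0) \<noteq> 0"
    by (simp add: poly_altdef[of t] poly_sum poly_0_coeff_0 coeff_sum)
  then obtain j where j: "coeff (coeff t j) 0 \<noteq> 0" by (meson sum.neutral)
  then have top: "coeff (coeff (coeff p 0) m) 0 \<noteq> 0" using h[of 0 j 0] by (auto simp: t_def)
  show "is_unit (lead_coeff (poly p 0))"
    using top h[of 0] by (intro unit_lead_coeff[of _ m]) (simp_all add: poly_0_coeff_0)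
  have c1: "coeff (coeff (poly p 1) j) i = (\<Sum>k\<le>degree p. coeff (coeff (coeff p k) j) i)" for i j
    by (simp add: poly_altdef coeff_sum)
  show "is_unit (lead_coeff (poly p 1))"
  proof (rule unit_lead_coeff[of _ m])
    fix i j assume "coeff (coeff (poly p 1) j) i \<noteq> 0"
    then obtain k where "coeff (coeff (coeff p k) j) i \<noteq> 0" unfolding c1 by (meson sum.neutral)
    then show "i + j \<le> m" using h by fastforce
  next
    have "(\<Sum>k\<le>degree p. coeff (coeff (coeff p k) m) 0) = (\<Sum>k\<in>{0}. coeff (coeff (coeff p k) m) 0)"
      using h[of _ m 0] by (intro sum.mono_neutral_right) auto
    then show "coeff (coeff (poly p 1) m) 0 \<noteq> 0" using top by (simp add: c1)
  qed
qed

text \<open>\<open>C\<close> lies in the ideal \<open>(p, q)\<close>, which contains no nonzero form of degree less than \<open>m\<close>.\<close>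

lemma syzygy_last_component:
  assumes hom: "homogeneous m p" "homogeneous m q" "homogeneous m r" "homogeneous e C" "e < m"
    and syz: "A * p + B * q + C * r = 0"
    and nz: "\<And>z. z \<noteq> 0 \<Longrightarrow> \<not> (eval p z = 0 \<and> eval q z = 0 \<and> eval r z = 0)"
    and p0: "eval p (pt 0 1 0) \<noteq> 0"
    and line: "\<And>v. \<not> (eval p (pt 1 v 0) = 0 \<and> eval q (pt 1 v 0) = 0)"
  shows "C = 0"
proof -
  note lc = unit_lead_coeff_slices[OF hom(1) p0]
  have "1 \<in> ideal3 (poly p 1) (poly q 1) (poly r 1)"
    using nz by (intro plane_nullstellensatz lc) (simp add: eval2_chart pt_eq_0)
  then obtain N where "z3 ^ N \<in> ideal3 p q r" using z3_power_in_ideal hom by blast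
  then obtain a b c where abc: "z3 ^ N = a * p + b * q + c * r" unfolding ideal3_def by blast
  have Cr: "C * r = - (A * p + B * q)" using syz by (metis add.commute eq_neg_iff_add_eq_0)
  have "(a * p + b * q + c * r) * C = a * C * p + b * C * q + c * (C * r)"
    by (simp add: algebra_simps)
  also have "\<dots> = (a * C - c * A) * p + (b * C - c * B) * q"
    unfolding Cr by (simp add: algebra_simps)
  finally have "z3 ^ N * C = (a * C - c * A) * p + (b * C - c * B) * q"
    unfolding abc .
  then obtain A' B' where "C = A' * p + B' * q"
    using z3_cancel[OF lc(1)] line by (metis eval2_line)
  with homogeneous_in_ideal hom show ?thesis by blast
qed

text \<open>The forms \<open>p\<close> and \<open>q + a r\<close> have a common zero \<open>(1, v, 0)\<close> only if \<open>v\<close> is one of the finitely many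
  zeros of \<open>p\<close> on this line and \<open>a\<close> is the value that makes \<open>q + a r\<close> vanish there; that value is unique since
  \<open>r\<close> does not vanish where \<open>p\<close> and \<open>q + a r\<close> do.\<close>

lemma syzygy_eq_0_of_first_nonzero:
  assumes hom: "homogeneous m p" "homogeneous m q" "homogeneous m r" 
     "homogeneous e B" "homogeneous e C" "e < m"
    and syz: "A * p + B * q + C * r = 0"
    and nz: "\<And>z. z \<noteq> 0 \<Longrightarrow> \<not> (eval p z = 0 \<and> eval q z = 0 \<and> eval r z = 0)"
    and p0: "eval p (pt 0 1 0) \<noteq> 0"
  shows "A = 0 \<and> B = 0 \<and> C = 0"
proof -
  define F where "F = {v. eval p (pt 1 v 0) = 0}"
  have "finite F"
  proof -
    have lc: "is_unit (lead_coeff (poly p 0))" by (rule unit_lead_coeff_slices[OF hom(1) p0])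
    then have "slice 1 (poly p 0) \<noteq> 0"
      by (metis coeff_map_poly degree_slice leading_coeff_0_iff is_unit_poly_iff poly_const_conv not_is_unit_0 poly_0)
    then have "finite {v. poly (slice 1 (poly p 0)) v = 0}" by (rule poly_roots_finite)
    then show ?thesis unfolding F_def poly_slice eval2_line .
  qed
  define bad where "bad = (\<lambda>v. - eval q (pt 1 v 0) / eval r (pt 1 v 0)) ` F"
  have good: "C = const3 a * B" if a: "a \<notin> bad" for a
  proof -
    have "C - const3 a * B = 0"
    proof (rule syzygy_last_component[OF hom(1) _ hom(3) _ hom(6) _ _ p0])
      show "homogeneous m (q + const3 a * r)"
        by (intro homogeneous_add homogeneous_smult hom)
      show "homogeneous e (C - const3 a * B)"
        by (intro homogeneous_diff homogeneous_smult hom)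
      show "A * p + B * (q + const3 a * r) + (C - const3 a * B) * r = 0"
      proof -
        have "A * p + B * (q + s * r) + (C - s * B) * r = A * p + B * q + C * r" for s
          by (simp add: algebra_simps)
        then show ?thesis using syz by (rule trans)
      qed
    next
      fix z :: "complex ^ 3" assume "z \<noteq> 0"
      from nz[OF this] show "\<not> (eval p z = 0 \<and> eval (q + const3 a * r) z = 0 \<and> eval r z = 0)"
        by (auto simp del: mult_pCons_left)
    next
      fix v
      show "\<not> (eval p (pt 1 v 0) = 0 \<and> eval (q + const3 a * r) (pt 1 v 0) = 0)"
      proof
        assume *: "eval p (pt 1 v 0) = 0 \<and> eval (q + const3 a * r) (pt 1 v 0) = 0"
        then have "eval q (pt 1 v 0) = - a * eval r (pt 1 v 0)"
          by (simp del: mult_pCons_left add: eq_neg_iff_add_eq_0)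
        moreover from this have "eval r (pt 1 v 0) \<noteq> 0" using * nz[of "pt 1 v 0"] by (auto simp: pt_eq_0)
        ultimately have "a = - eval q (pt 1 v 0) / eval r (pt 1 v 0)" by (simp add: field_simps)
        with * a show False by (auto simp: bad_def F_def)
      qed
    qed
    then show ?thesis by simp
  qed
  have "finite bad" using \<open>finite F\<close> by (simp add: bad_def)
  then obtain a where a: "a \<notin> bad" using ex_new_if_finite infinite_UNIV_char_0 by blast
  obtain b where b: "b \<notin> insert a bad"
    using ex_new_if_finite infinite_UNIV_char_0 \<open>finite bad\<close> by (metis finite_insert)
  have "const3 (a - b) * B = const3 a * B - const3 b * B"
    by (simp add: smult_diff_left[symmetric])
  also have "\<dots> = 0" using good[of a] good[of b] a b by simp
  finally have B: "B = 0" using b by (auto simp del: mult_pCons_left)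
  moreover have "C = 0" using good[OF a] B by simp
  moreover have "p \<noteq> 0" using p0 by auto
  ultimately show ?thesis using syz by simp
qed

text \<open>Some \<open>p\<^sub>i\<close> does not vanish at \<open>(0, 1, 0)\<close>; permuting indices, it may be taken to be the first one.\<close>

theorem syzygy_eq_0:
  fixes p Q :: "S ^ 3"
  assumes hom: "\<And>i. homogeneous m (p $ i)" "\<And>i. homogeneous e (Q $ i)" "e < m"
    and syz: "(\<Sum>i\<in>UNIV. Q $ i * p $ i) = 0"
    and nz: "\<And>z. z \<noteq> 0 \<Longrightarrow> \<exists>i. eval (p $ i) z \<noteq> 0"
  shows "Q = 0"
proof -
  have sum: "Q $ 1 * p $ 1 + Q $ 2 * p $ 2 + Q $ 3 * p $ 3 = 0" using syz by (simp only: sum_3)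
  have nz': "\<not> (eval (p $ 1) z = 0 \<and> eval (p $ 2) z = 0 \<and> eval (p $ 3) z = 0)" if "z \<noteq> 0" for z
    using nz[OF that] forall_3[of "\<lambda>i. eval (p $ i) z = 0"] by blast
  note aux = syzygy_eq_0_of_first_nonzero[OF hom(1) hom(1) hom(1) hom(2) hom(2) hom(3)]
  have "\<exists>i. eval (p $ i) (pt 0 1 0) \<noteq> 0" by (rule nz) (simp add: pt_eq_0)
  then consider "eval (p $ 1) (pt 0 1 0) \<noteq> 0" | "eval (p $ 2) (pt 0 1 0) \<noteq> 0"
    | "eval (p $ 3) (pt 0 1 0) \<noteq> 0" using forall_3[of "\<lambda>i. eval (p $ i) (pt 0 1 0) = 0"] by blast
  then have "Q $ 1 = 0 \<and> Q $ 2 = 0 \<and> Q $ 3 = 0"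
  proof cases
    case 1
    from aux[OF sum nz' 1] show ?thesis .
  next
    case 2
    have "Q $ 2 * p $ 2 + Q $ 1 * p $ 1 + Q $ 3 * p $ 3 = 0" using sum by (simp only: add_ac)
    from aux[OF this _ 2] nz' show ?thesis by blast
  next
    case 3
    have "Q $ 3 * p $ 3 + Q $ 1 * p $ 1 + Q $ 2 * p $ 2 = 0" using sum by (simp only: add_ac)
    from aux[OF this _ 3] nz' show ?thesis by blast
  qed
  then show ?thesis by (simp only: vec_eq_iff forall_3 zero_index)
qed


section \<open>Irreducibility of the surface\<close>

text \<open>Multiplying \<open>h\<close> by \<open>z\<^sub>3\<close> keeps the point found away from the origin.\<close>

lemma exists_nonzero_value:
  assumes "h \<noteq> 0"
  shows "\<exists>z. z \<noteq> 0 \<and> eval h z \<noteq> 0"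
proof -
  have ex: "\<exists>c. poly g (\<iota> c) \<noteq> 0" if "g \<noteq> 0" "inj \<iota>" for g :: "'a::idom poly" and \<iota> :: "complex \<Rightarrow> 'a"
  proof (rule ccontr)
    assume "\<nexists>c. poly g (\<iota> c) \<noteq> 0"
    then have "range \<iota> \<subseteq> {x. poly g x = 0}" by auto
    then have "finite (range \<iota>)" using poly_roots_finite[OF that(1)] finite_subset by blast
    then show False using that(2) infinite_UNIV_char_0 finite_imageD by blast
  qed
  define g where "g = z3 * h"
  have "g \<noteq> 0" using assms by (simp add: g_def)
  then obtain z where "poly g [:[:z:]:] \<noteq> 0" using ex[of g "\<lambda>c. [:[:c:]:]"] by (auto simp: inj_def)
  then obtain y where "poly (poly g [:[:z:]:]) [:y:] \<noteq> 0" using ex[of _ "\<lambda>c. [:c:]"] by (force simp: inj_def)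
  then obtain x where "poly (poly (poly g [:[:z:]:]) [:y:]) x \<noteq> 0" using ex[of _ "\<lambda>c. c"] by (force simp: inj_def)
  then have *: "eval g (pt x y z) \<noteq> 0" by (simp add: eval_def)
  have "eval g (pt x y z) = z * eval h (pt x y z)" by (simp add: g_def eval_def)
  with * have "z \<noteq> 0" "eval h (pt x y z) \<noteq> 0" by auto
  then show ?thesis by (intro exI[of _ "pt x y z"]) (simp add: pt_eq_0)
qed

text \<open>For an intersection take the product of the polynomials: a point where it does not vanish represents
  an orbit lying in both sets.\<close>

lemma zariski_open_dense:
  assumes "openin zariski U" "U \<noteq> {}"
  shows "\<exists>h. h \<noteq> 0 \<and> orbit ` {z. z \<noteq> 0 \<and> eval h z \<noteq> 0} \<subseteq> U"
proof -
  have "generate_topology_on {orbit ` {z. z \<noteq> 0 \<and> eval h z \<noteq> 0} | h. \<exists>\<alpha>. quasi_homogeneous \<alpha> h} U"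
    using assms(1) by (simp add: zariski_def openin_topology_generated_by_iff)
  then show ?thesis using assms(2)
  proof induction
    case Empty
    then show ?case by simp
  next
    case (Int a b)
    then obtain h k where hk: "h \<noteq> 0" "orbit ` {z. z \<noteq> 0 \<and> eval h z \<noteq> 0} \<subseteq> a"
      "k \<noteq> 0" "orbit ` {z. z \<noteq> 0 \<and> eval k z \<noteq> 0} \<subseteq> b" by blast
    then have "h * k \<noteq> 0" "orbit ` {z. z \<noteq> 0 \<and> eval (h * k) z \<noteq> 0} \<subseteq> a \<inter> b" by auto
    then show ?case by blast
  next
    case (UN K)
    then obtain k where k: "k \<in> K" "k \<noteq> {}" by auto
    from UN.IH[OF this] obtain h
      where "h \<noteq> 0" "orbit ` {z. z \<noteq> 0 \<and> eval h z \<noteq> 0} \<subseteq> k" by (elim exE conjE)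
    then show ?case using Union_upper[OF k(1)] by (meson subset_trans)
  next
    case (Basis s)
    then obtain h where h: "s = orbit ` {z. z \<noteq> 0 \<and> eval h z \<noteq> 0}" by blast
    then have "h \<noteq> 0" using Basis by auto
    with h show ?case by blast
  qed
qed

lemma topspace_zariski: "topspace zariski = orbit ` {z. z \<noteq> 0}"
proof -
  have "quasi_homogeneous 0 1"
    unfolding quasi_homogeneous_def mcoeff_def monomial_degree_def
    by (auto simp: coeff_1 sum_3 split: if_splits)
  then have "openin zariski (orbit ` {z. z \<noteq> 0 \<and> eval 1 z \<noteq> 0})"
    unfolding zariski_def by (intro topology_generated_by_Basis) blast
  then have "orbit ` {z. z \<noteq> 0} \<subseteq> topspace zariski"
    using openin_subset by simp
  moreover have "topspace zariski \<subseteq> orbit ` {z. z \<noteq> 0}"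
    unfolding zariski_def topology_generated_by_topspace by auto
  ultimately show ?thesis by blast
qed

lemma irreducible_zariski: "irreducible_closed zariski (topspace zariski)"
  unfolding irreducible_closed_def
proof (intro conjI allI impI)
  show "topspace zariski \<noteq> {}" unfolding topspace_zariski
    using exists_nonzero_value[of 1] by auto
  fix A B assume AB: "closedin zariski A \<and> closedin zariski B \<and> topspace zariski = A \<union> B"
  show "topspace zariski = A \<or> topspace zariski = B"
  proof (rule ccontr)
    assume "\<not> ?thesis"
    with AB have "topspace zariski - A \<noteq> {}" "topspace zariski - B \<noteq> {}" by auto
    moreover have "openin zariski (topspace zariski - A)" "openin zariski (topspace zariski - B)"
      using AB openin_diff[OF openin_topspace] by blast+
    ultimately obtain h k where hk: "h \<noteq> 0" "orbit ` {z. z \<noteq> 0 \<and> eval h z \<noteq> 0} \<subseteq> topspace zariski - A"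
      "k \<noteq> 0" "orbit ` {z. z \<noteq> 0 \<and> eval k z \<noteq> 0} \<subseteq> topspace zariski - B"
      by (auto dest!: zariski_open_dense)
    then obtain z where "z \<noteq> 0" "eval (h * k) z \<noteq> 0" using exists_nonzero_value[of "h * k"] by auto
    then have "orbit z \<in> topspace zariski - A" "orbit z \<in> topspace zariski - B" using hk by auto
    with AB show False by blast
  qed
qed simp

text \<open>No closed set is strictly larger than the whole space, so a chain starting there has length \<open>0\<close>.\<close>

lemma codimension_topspace:
  assumes "irreducible_closed T (topspace T)"
  shows "codimension T (topspace T) = 0"
proof -
  have "codimension T (topspace T) \<le> (SUP n\<in>{n. \<exists>C :: nat \<Rightarrow> 'a set. C 0 = topspace T \<and>
      (\<forall>i\<le>n. irreducible_closed T (C i)) \<and> (\<forall>i<n. C i \<subset> C (Suc i))}. enat n)"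
    unfolding codimension_def using assms by (intro INF_lower) simp
  also have "\<dots> \<le> 0"
  proof (rule SUP_least, clarify)
    fix n and C :: "nat \<Rightarrow> 'a set"
    assume C: "C 0 = topspace T" "\<forall>i\<le>n. irreducible_closed T (C i)" "\<forall>i<n. C i \<subset> C (Suc i)"
    have "n = 0"
    proof (rule ccontr)
      assume "n \<noteq> 0"
      then have "C 0 \<subset> C 1" "irreducible_closed T (C 1)" using C by auto
      moreover from this have "C 1 \<subseteq> topspace T"
        by (simp add: irreducible_closed_def closedin_subset)
      ultimately show False using C(1) by auto
    qed
    then show "enat n \<le> 0" by (simp add: zero_enat_def)
  qed
  finally show ?thesis by simp
qed

lemma minors_not_all_zero:
  assumes "codimension zariski (Sing X) \<ge> 2"
  shows "\<exists>i j. radial $ i * X $ j \<noteq> radial $ j * X $ i"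
proof (rule ccontr)
  assume "\<not> ?thesis"
  then have "Sing X = topspace zariski" unfolding Sing_def topspace_zariski by simp
  with assms codimension_topspace[OF irreducible_zariski] show False by simp
qed

section \<open>Euler's identity and the degree bound\<close>

lemma coords_simps: "coords $ 1 = [:[:[:0, 1:]:]:]" "coords $ 2 = [:[:0, 1:]:]" "coords $ 3 = z3"
  by (simp_all add: coords_def vector_3)

lemma grad_simps:
  "grad f $ 1 = map_poly (map_poly pderiv) f" "grad f $ 2 = map_poly pderiv f" "grad f $ 3 = pderiv f"
  by (simp_all add: grad_def vector_3)

abbreviation co :: "S \<Rightarrow> nat \<Rightarrow> nat \<Rightarrow> nat \<Rightarrow> complex" where
  "co f i j k \<equiv> coeff (coeff (coeff f k) j) i"

lemma coeff_grad:
  "co (grad f $ 1) i j k = of_nat (Suc i) * co f (Suc i) j k"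
  "co (grad f $ 2) i j k = of_nat (Suc j) * co f i (Suc j) k"
  "co (grad f $ 3) i j k = of_nat (Suc k) * co f i j (Suc k)"
  unfolding grad_simps
  by (simp_all add: coeff_map_poly coeff_pderiv of_nat_poly of_nat_Suc[symmetric] del: of_nat_Suc)

lemma coeff_coords_mult:
  "co (coords $ 1 * f) i j k = (if i = 0 then 0 else co f (i - 1) j k)"
  "co (coords $ 2 * f) i j k = (if j = 0 then 0 else co f i (j - 1) k)"
  "co (coords $ 3 * f) i j k = (if k = 0 then 0 else co f i j (k - 1))"
  unfolding coords_simps by (simp_all add: coeff_pCons split: nat.splits)

lemma homogeneous_coords: "homogeneous 1 (coords $ l)"
proof -
  have "homogeneous 1 (coords $ 1)" "homogeneous 1 (coords $ 2)" "homogeneous 1 (coords $ 3)"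
    unfolding coords_simps by (auto simp: homogeneous_iff coeff_pCons split: nat.splits)
  then show ?thesis using forall_3[of "\<lambda>l. homogeneous 1 (coords $ l)"] by blast
qed

lemma homogeneous_grad:
  assumes "homogeneous n f"
  shows "homogeneous (n - 1) (grad f $ l)"
proof -
  have "homogeneous (n - 1) (grad f $ 1)" "homogeneous (n - 1) (grad f $ 2)" "homogeneous (n - 1) (grad f $ 3)"
    using assms unfolding homogeneous_iff coeff_grad by fastforce+
  then show ?thesis using forall_3[of "\<lambda>l. homogeneous (n - 1) (grad f $ l)"] by blast
qed

lemma euler:
  assumes "homogeneous n f"
  shows "apply_field coords f = const3 (of_nat n) * f"
proof -
  have "co (coords $ 1 * grad f $ 1 + coords $ 2 * grad f $ 2 + coords $ 3 * grad f $ 3) i j k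
     = of_nat (i + j + k) * co f i j k" for i j k
    unfolding coeff_add coeff_coords_mult coeff_grad
    by (cases i; cases j; cases k) (simp_all add: algebra_simps)
  moreover have "of_nat (i + j + k) * co f i j k = of_nat n * co f i j k" for i j k
    using assms unfolding homogeneous_iff by (metis mult_zero_right)
  ultimately show ?thesis
    unfolding apply_field_def sum_3 by (intro poly_eqI) simp
qed

lemma fst_monomial_degree: "fst (monomial_degree e) = int (e $ 1 + e $ 2 + e $ 3)"
proof -
  have "fst (deg_z $ i) = 1" for i
    using forall_3[of "\<lambda>i. fst (deg_z $ i) = 1"] by (simp add: deg_z_def)
  then show ?thesis unfolding monomial_degree_def by (simp add: fst_sum sum_3)
qed

lemma homogeneous_of_quasi_homogeneous:
  assumes "quasi_homogeneous \<alpha> f"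
  shows "f \<noteq> 0 \<Longrightarrow> fst \<alpha> \<ge> 0" "homogeneous (nat (fst \<alpha>)) f"
proof -
  have *: "int (i + j + k) = fst \<alpha>" if "co f i j k \<noteq> 0" for i j k
  proof -
    have "mcoeff f (vector [i, j, k]) \<noteq> 0" using that by (simp add: mcoeff_def vector_3)
    then have "monomial_degree (vector [i, j, k]) = \<alpha>" using assms by (simp add: quasi_homogeneous_def)
    then show ?thesis using fst_monomial_degree[of "vector [i, j, k]"] by (simp add: vector_3)
  qed
  then show "homogeneous (nat (fst \<alpha>)) f" unfolding homogeneous_iff by force
  assume "f \<noteq> 0"
  then obtain i j k where "co f i j k \<noteq> 0" by (metis leading_coeff_0_iff)
  from *[OF this] show "fst \<alpha> \<ge> 0" by simp
qed

lemma homogeneous_0_const: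
  assumes "homogeneous 0 f" shows "\<exists>c. f = const3 c"
proof
  have z: "co f i j k = 0" if "i + j + k \<noteq> 0" for i j k
    using assms that unfolding homogeneous_iff by blast
  show "f = const3 (co f 0 0 0)"
    by (intro poly_eqI) (auto simp: coeff_pCons z split: nat.splits)
qed

theorem corollary5p4:
  fixes \<F> :: "vector_field set" and X :: vector_field and f :: S and \<alpha> \<beta> :: degree_group
  assumes "foliation \<alpha> \<F>"
    and "X \<in> \<F>"
    and "hypersurface \<beta> f"
    and "quasi_smooth f"
    and "invariant_by X f"
  shows "fst \<beta> \<le> fst \<alpha> + 2"
proof -
  obtain Y h where Y: "quasi_homogeneous_field \<alpha> Y" "codimension zariski (Sing Y) \<ge> 2"
    and X: "X = Y + h *s radial"
    using assms(1,2) unfolding foliation_def by fast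
  obtain g0 where g0: "apply_field X f = g0 * f"
    using assms(5) unfolding invariant_by_def by blast
  define n where "n = nat (fst \<beta>)"
  define e where "e = nat (fst \<alpha> + 1)"
  have qf: "quasi_homogeneous \<beta> f" and nconst: "\<nexists>c. f = const3 c"
    using assms(3) by (auto simp: hypersurface_def)
  have f: "homogeneous n f" using homogeneous_of_quasi_homogeneous[OF qf] by (simp add: n_def)
  have f0: "f \<noteq> 0" using nconst by (metis pCons_0_0)
  have n: "n > 0" using f nconst homogeneous_0_const by (cases n) auto
  have fb: "fst \<beta> = int n" using n by (simp add: n_def)
  have fstz: "fst (\<alpha> + deg_z $ i) = fst \<alpha> + 1" for i
    using forall_3[of "\<lambda>i. fst (deg_z $ i) = 1"] by (simp add: deg_z_def)
  have qY: "quasi_homogeneous (\<alpha> + deg_z $ i) (Y $ i)" for i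
    using Y(1) by (simp add: quasi_homogeneous_field_def)
  have hY: "homogeneous e (Y $ i)" for i
    using homogeneous_of_quasi_homogeneous(2)[OF qY[of i]] unfolding fstz e_def .
  define s where "s = const3 (of_nat n)"
  have s0: "s \<noteq> 0" using n by (simp add: s_def)
  \<comment> \<open>\<open>X\<close> and \<open>Y\<close> differ by \<open>h R\<close>, so the cofactor of \<open>f\<close> changes by \<open>n h\<close>.\<close>
  define g where "g = g0 - h * s"
  have Yf: "apply_field Y f = g * f"
  proof -
    have "apply_field X f = apply_field Y f + h * apply_field coords f"
      unfolding X radial_def apply_field_def sum_3 by (simp add: algebra_simps)
    then show ?thesis using g0 euler[OF f] unfolding g_def s_def[symmetric] by (simp add: algebra_simps)
  qed
  have hYf: "homogeneous (e + (n - 1)) (g * f)"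
    unfolding Yf[symmetric] apply_field_def sum_3
    by (intro homogeneous_add homogeneous_mult hY homogeneous_grad f)
  define Q where "Q = (\<chi> i. s * Y $ i - g * coords $ i)"
  \<comment> \<open>The degree of \<open>g\<close> itself could be \<open>-1\<close>, with \<open>g = 0\<close>; that of \<open>g z\<^sub>i\<close> is a natural number, read off after
    multiplication by \<open>f\<close>.\<close>
  have hQ: "homogeneous e (Q $ i)" for i
  proof -
    have "homogeneous (1 + (e + (n - 1))) (coords $ i * (g * f))"
      by (intro homogeneous_mult homogeneous_coords hYf)
    then have "homogeneous (e + n) (g * coords $ i * f)" using n by (simp add: mult_ac)
    then have "homogeneous e (g * coords $ i)" using homogeneous_cancel f f0 by blast
    then show ?thesis
      unfolding Q_def s_def vec_lambda_beta by (intro homogeneous_diff homogeneous_smult hY)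
  qed
  have syz: "(\<Sum>i\<in>UNIV. Q $ i * grad f $ i) = 0"
  proof -
    have "(\<Sum>i\<in>UNIV. Q $ i * grad f $ i) = s * apply_field Y f - g * apply_field coords f"
      unfolding apply_field_def sum_3 Q_def by (simp add: algebra_simps)
    also have "\<dots> = 0" unfolding Yf euler[OF f] s_def[symmetric] by (simp add: algebra_simps)
    finally show ?thesis .
  qed
  have nz: "\<exists>i. eval (grad f $ i) z \<noteq> 0" if "z \<noteq> 0" for z
  proof (rule ccontr)
    assume *: "\<nexists>i. eval (grad f $ i) z \<noteq> 0"
    have "eval (s * f) z = eval (apply_field coords f) z" using euler[OF f] by (simp add: s_def)
    also have "\<dots> = 0" using * by (simp add: apply_field_def sum_3)
    finally have "eval f z = 0" using n by (simp add: s_def del: mult_pCons_left)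
    with * that assms(4) show False unfolding quasi_smooth_def by blast
  qed
  have Q0: "Q \<noteq> 0"
  proof
    assume "Q = 0"
    then have sY: "s * Y $ i = g * coords $ i" for i
      unfolding Q_def by (simp add: vec_eq_iff)
    obtain i j where ij: "radial $ i * Y $ j \<noteq> radial $ j * Y $ i"
      using minors_not_all_zero[OF Y(2)] by blast
    have "s * (radial $ i * Y $ j) = radial $ i * (s * Y $ j)" by (simp only: mult_ac)
    also have "\<dots> = radial $ j * (s * Y $ i)" unfolding sY radial_def by (simp only: mult_ac)
    also have "\<dots> = s * (radial $ j * Y $ i)" by (simp only: mult_ac)
    finally show False using ij s0 by simp
  qed
  have "fst \<alpha> + 1 \<ge> 0"
  proof (rule ccontr)
    assume neg: "\<not> fst \<alpha> + 1 \<ge> 0"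
    have "Y $ i = 0" for i
      using homogeneous_of_quasi_homogeneous(1)[OF qY[of i]] neg unfolding fstz by blast
    then show False using minors_not_all_zero[OF Y(2)] by simp
  qed
  moreover have "\<not> e < n - 1"
    using syzygy_eq_0[of "n - 1" "grad f" e Q] homogeneous_grad[OF f] hQ syz nz Q0 by blast
  ultimately show ?thesis using n unfolding fb e_def by linarith
qed

end
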